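(* Let $Q$ be a commutative ring, $A$ a graded-commutative DG $Q$-algebra, $X$ a DG $A$-module, and suppose $(\bm{\alpha},\bm{\beta},\bm{\gamma},\bm{\tau})$ is a perturbing system on $X$, where $\bm{\alpha}=\alpha_1,\ldots,\alpha_n$, $\bm{\beta}=\beta_1,\ldots,\beta_n$, $\bm{\gamma}=\gamma_1,\ldots,\gamma_n$ and $\bm{\tau}=\{\tau^{(H)}\}_{H\in\mathbb{N}^n}$. Set $\delta=\sum_{i=1}^n\gamma_i\alpha_i$ and $\epsilon=\sum_{i=1}^n\gamma_i\beta_i$. Then the morphism of DG $A$-modules $$\bm{\gamma\tau}:X^\delta\to X^\epsilon,\qquad x\mapsto\sum_{H\in\mathbb{N}^n}\gamma^H\tau^{(H)}(x),$$ is an isomorphism.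
   Context: For DG $A$-modules, $\mathrm{Hom}_A(X,X)$ is the complex whose degree $d$ elements are the degree $d$ $Q$-linear maps $\alpha:X\to X$ with $\alpha(ax)=(-1)^{d|a|}a\alpha(x)$ for all $a\in A$, $x\in X$; its differential is $\alpha\mapsto[\partial^X,\alpha]$, where $[\alpha,\beta]=\alpha\beta-(-1)^{|\alpha||\beta|}\beta\alpha$. $Z(-)$ denotes cycles. An element $\gamma\in\mathrm{Hom}_A(X,X)$ is a central map if $\gamma\sigma=(-1)^{|\sigma||\gamma|}\sigma\gamma$ for all $\sigma\in\mathrm{Hom}_A(X,X)$. Perturbation: if $\delta\in Z_{-1}(\mathrm{Hom}_A(X,X))$ satisfies $\delta^2=0$, then $X^\delta$ is the DG $A$-module with the same underlying graded $A$-module as $X$ and with differential $\partial^X+\delta$. For $H=(h_1,\ldots,h_n)\in\mathbb{N}^n$ put $|H|=h_1+\cdots+h_n$, and if $h_i\ge1$ put $H_i=(h_1,\ldots,h_{i-1},h_i-1,h_{i+1},\ldots,h_n)$. If $h_i=0$, use the convention $\tau^{(H_i)}=0$. Strong homotopies: let $\bm{\alpha},\bm{\beta}$ be sequences of $n$ elements of $\mathrm{Hom}_A(X,X)_d$. A system of higher strong homotopies from $\bm{\alpha}$ to $\bm{\beta}$ is a family $\bm{\tau}=\{\tau^{(H)}\}_{H\in\mathbb{N}^n}$ in $\mathrm{Hom}_A(X,X)$ such that (i) $|\tau^{(H)}|=|H|(d+1)$; (ii) $\tau^{(\bm{0})}=\mathrm{id}^X$; (iii) $[\partial^X,\tau^{(H)}]=\sum_{i=1}^n\left(\tau^{(H_i)}\alpha_i-\beta_i\tau^{(H_i)}\right)$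 for each $|H|>0$. Perturbing system: let $\bm{\alpha}$ and $\bm{\beta}$ be sequences of $n$ maps in $\mathrm{Hom}_A(X,X)$ of positive odd degree $d$, let $\bm{\gamma}=\gamma_1,\ldots,\gamma_n$ be a sequence of central maps on $X$ of degree $|\gamma_i|=-d-1$, and set $\delta=\sum_i\gamma_i\alpha_i$, $\epsilon=\sum_i\gamma_i\beta_i$. Then $(\bm{\alpha},\bm{\beta},\bm{\gamma},\bm{\tau})$ is a perturbing system on $X$ if: (1) $\bm{\tau}$ is a system of higher strong homotopies from $\bm{\alpha}$ to $\bm{\beta}$; (2) $\delta,\epsilon\in Z_{-1}(\mathrm{Hom}_A(X,X))$; (3) $\delta^2=0$ and $\epsilon^2=0$; (4) for each $x\in X$, $\gamma^H(x)=0$ for all $|H|\gg0$, where $\gamma^H=\gamma_1^{h_1}\cdots\gamma_n^{h_n}$ and $\gamma^{\bm{0}}=\mathrm{id}^X$. The sum defining $\bm{\gamma\tau}(x)$ is finite by (4), because $\gamma^H\tau^{(H)}=\tau^{(H)}\gamma^H$.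
   Formalization: γτ need not commute with the differentials, as central maps need not be cycles; so it is proved to be an isomorphism of graded A-modules always, and of DG A-modules whenever it is a DG morphism, in particular whenever all γ_i are cycles. *)

theory Defs
  imports Complex_Main
begin

text \<open>
  Gradings are internal and by the integers; complexes are graded homologically
  (differentials have degree -1).  The element \<^term>\<open>ksgn k x\<close> is the Koszul-signed
  element (-1)^k x.
\<close>

definition ksgn :: "int \<Rightarrow> 'm::ab_group_add \<Rightarrow> 'm" where
  "ksgn k x = (if even k then x else - x)"

record ('q, 'm) gr_mod =
  scale :: "'q \<Rightarrow> 'm \<Rightarrow> 'm"
  hgrade :: "int \<Rightarrow> 'm set"

record ('q, 'm) cplx = "('q, 'm) gr_mod" +
  diff :: "'m \<Rightarrow> 'm"

record ('q, 'a, 'm) dg_mod = "('q, 'm) cplx" +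
  act :: "'a \<Rightarrow> 'm \<Rightarrow> 'm"

locale graded_module = module "scale M"
  for M :: "('q::comm_ring_1, 'm::ab_group_add, 'z) gr_mod_scheme" +
  assumes hgrade_subspace: "subspace (hgrade M i)"
    and direct_sum: "\<exists>!c :: int \<Rightarrow> 'm. finite {i. c i \<noteq> 0} \<and> (\<forall>i. c i \<in> hgrade M i)
                        \<and> x = (\<Sum>i | c i \<noteq> 0. c i)"

locale dg_complex = graded_module M
  for M :: "('q::comm_ring_1, 'm::ab_group_add, 'z) cplx_scheme" +
  assumes diff_linear: "module_hom (scale M) (scale M) (diff M)"
    and diff_degree: "x \<in> hgrade M i \<Longrightarrow> diff M x \<in> hgrade M (i - 1)"
    and diff_diff: "diff M (diff M x) = 0"

text \<open>
  The ring structure of a DG algebra is that of its type; \<^term>\<open>A\<close> supplies the scalar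
  multiplication of the ground ring, the grading and the differential.
\<close>

locale dg_algebra = dg_complex A
  for A :: "('q::comm_ring_1, 'a::ring_1, 'z) cplx_scheme" +
  assumes scale_mult_left: "scale A q (a * b) = scale A q a * b"
    and scale_mult_right: "scale A q (a * b) = a * scale A q b"
    and one_degree: "1 \<in> hgrade A 0"
    and mult_degree: "a \<in> hgrade A i \<Longrightarrow> b \<in> hgrade A j \<Longrightarrow> a * b \<in> hgrade A (i + j)"
    and Leibniz: "a \<in> hgrade A i \<Longrightarrow> diff A (a * b) = diff A a * b + ksgn i (a * diff A b)"

locale gc_dg_algebra = dg_algebra A
  for A :: "('q::comm_ring_1, 'a::ring_1, 'z) cplx_scheme" +
  assumes graded_comm: "a \<in> hgrade A i \<Longrightarrow> b \<in> hgrade A j \<Longrightarrow> a * b = ksgn (i * j) (b * a)"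

locale dg_module = A: dg_algebra A + X: dg_complex X
  for A :: "('q::comm_ring_1, 'a::ring_1, 'y) cplx_scheme"
    and X :: "('q, 'a, 'x::ab_group_add, 'z) dg_mod_scheme" +
  assumes act_add_left: "act X (a + b) x = act X a x + act X b x"
    and act_add_right: "act X a (x + y) = act X a x + act X a y"
    and act_mult: "act X (a * b) x = act X a (act X b x)"
    and act_one: "act X 1 x = x"
    and act_scale_left: "act X (scale A q a) x = scale X q (act X a x)"
    and act_scale_right: "act X a (scale X q x) = scale X q (act X a x)"
    and act_degree: "a \<in> hgrade A i \<Longrightarrow> x \<in> hgrade X j \<Longrightarrow> act X a x \<in> hgrade X (i + j)"
    and act_Leibniz: "a \<in> hgrade A i \<Longrightarrow>
           diff X (act X a x) = act X (diff A a) x + ksgn i (act X a (diff X x))"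


text \<open>
  \<^term>\<open>Hom_deg A X d\<close> is the degree \<^term>\<open>d\<close> component of the complex Hom_A(X,X).
  As the zero map lies in every degree, operations that depend on degrees take them
  as explicit arguments.
\<close>

definition Hom_deg ::
  "('q::comm_ring_1, 'a::ring_1, 'y) cplx_scheme \<Rightarrow> ('q, 'a, 'x::ab_group_add, 'z) dg_mod_scheme
     \<Rightarrow> int \<Rightarrow> ('x \<Rightarrow> 'x) set" where
  "Hom_deg A X d = {f. module_hom (scale X) (scale X) f
      \<and> (\<forall>i. \<forall>x \<in> hgrade X i. f x \<in> hgrade X (i + d))
      \<and> (\<forall>i. \<forall>a \<in> hgrade A i. \<forall>x. f (act X a x) = ksgn (d * i) (act X a (f x)))}"

definition gcomm :: "int \<Rightarrow> ('x \<Rightarrow> 'x) \<Rightarrow> int \<Rightarrow> ('x \<Rightarrow> 'x) \<Rightarrow> 'x \<Rightarrow> 'x::ab_group_add" where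
  "gcomm p f q g = (\<lambda>x. f (g x) - ksgn (p * q) (g (f x)))"

definition hom_diff ::
  "('q, 'a, 'x::ab_group_add, 'z) dg_mod_scheme \<Rightarrow> int \<Rightarrow> ('x \<Rightarrow> 'x) \<Rightarrow> 'x \<Rightarrow> 'x" where
  "hom_diff X d f = gcomm (-1) (diff X) d f"

definition Hom_cycles ::
  "('q::comm_ring_1, 'a::ring_1, 'y) cplx_scheme \<Rightarrow> ('q, 'a, 'x::ab_group_add, 'z) dg_mod_scheme
     \<Rightarrow> int \<Rightarrow> ('x \<Rightarrow> 'x) set" where
  "Hom_cycles A X d = {f \<in> Hom_deg A X d. hom_diff X d f = (\<lambda>_. 0)}"

text \<open>
  A central map need not be a cycle, since the differential of X is in general not in
  Hom_A(X,X): multiplication by a homogeneous a in A of even degree is central,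
  and its boundary is multiplication by the differential of a.
\<close>

definition central_map ::
  "('q::comm_ring_1, 'a::ring_1, 'y) cplx_scheme \<Rightarrow> ('q, 'a, 'x::ab_group_add, 'z) dg_mod_scheme
     \<Rightarrow> int \<Rightarrow> ('x \<Rightarrow> 'x) \<Rightarrow> bool" where
  "central_map A X g \<gamma> \<longleftrightarrow> \<gamma> \<in> Hom_deg A X g
     \<and> (\<forall>s. \<forall>\<sigma> \<in> Hom_deg A X s. \<gamma> \<circ> \<sigma> = (\<lambda>x. ksgn (s * g) (\<sigma> (\<gamma> x))))"

definition perturb ::
  "('q, 'a, 'x::ab_group_add, 'z) dg_mod_scheme \<Rightarrow> ('x \<Rightarrow> 'x) \<Rightarrow> ('q, 'a, 'x, 'z) dg_mod_scheme"
  where "perturb X \<delta> = X\<lparr>diff := (\<lambda>x. diff X x + \<delta> x)\<rparr>"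


text \<open>
  Sequences of length \<^term>\<open>n\<close> are indexed by the numbers below \<^term>\<open>n\<close>; a multi-index is a
  function on the naturals vanishing from \<^term>\<open>n\<close> on.
\<close>

definition mindex :: "nat \<Rightarrow> (nat \<Rightarrow> nat) set" where
  "mindex n = {H. \<forall>i\<ge>n. H i = 0}"

definition msize :: "nat \<Rightarrow> (nat \<Rightarrow> nat) \<Rightarrow> nat" where
  "msize n H = (\<Sum>i<n. H i)"

definition at_dec ::
  "((nat \<Rightarrow> nat) \<Rightarrow> 'x \<Rightarrow> 'x) \<Rightarrow> (nat \<Rightarrow> nat) \<Rightarrow> nat \<Rightarrow> 'x \<Rightarrow> 'x::ab_group_add" where
  "at_dec \<tau> H i = (if H i = 0 then (\<lambda>_. 0) else \<tau> (H(i := H i - 1)))"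

primrec mpow :: "nat \<Rightarrow> (nat \<Rightarrow> 'x \<Rightarrow> 'x) \<Rightarrow> (nat \<Rightarrow> nat) \<Rightarrow> 'x \<Rightarrow> 'x" where
  "mpow 0 \<gamma> H = id"
| "mpow (Suc k) \<gamma> H = mpow k \<gamma> H \<circ> (\<gamma> k ^^ H k)"

definition strong_homotopies ::
  "('q::comm_ring_1, 'a::ring_1, 'y) cplx_scheme \<Rightarrow> ('q, 'a, 'x::ab_group_add, 'z) dg_mod_scheme
     \<Rightarrow> nat \<Rightarrow> int \<Rightarrow> (nat \<Rightarrow> 'x \<Rightarrow> 'x) \<Rightarrow> (nat \<Rightarrow> 'x \<Rightarrow> 'x) \<Rightarrow> ((nat \<Rightarrow> nat) \<Rightarrow> 'x \<Rightarrow> 'x) \<Rightarrow> bool"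
  where
  "strong_homotopies A X n d \<alpha> \<beta> \<tau> \<longleftrightarrow>
     (\<forall>i<n. \<alpha> i \<in> Hom_deg A X d \<and> \<beta> i \<in> Hom_deg A X d)
   \<and> (\<forall>H \<in> mindex n. \<tau> H \<in> Hom_deg A X (int (msize n H) * (d + 1)))
   \<and> \<tau> (\<lambda>_. 0) = id
   \<and> (\<forall>H \<in> mindex n. msize n H > 0 \<longrightarrow>
        hom_diff X (int (msize n H) * (d + 1)) (\<tau> H)
          = (\<lambda>x. \<Sum>i<n. at_dec \<tau> H i (\<alpha> i x) - \<beta> i (at_dec \<tau> H i x)))"

definition weighted_sum :: "nat \<Rightarrow> (nat \<Rightarrow> 'x \<Rightarrow> 'x) \<Rightarrow> (nat \<Rightarrow> 'x \<Rightarrow> 'x) \<Rightarrow> 'x \<Rightarrow> 'x::ab_group_add"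
  where "weighted_sum n \<gamma> \<alpha> = (\<lambda>x. \<Sum>i<n. \<gamma> i (\<alpha> i x))"

definition perturbing_system ::
  "('q::comm_ring_1, 'a::ring_1, 'y) cplx_scheme \<Rightarrow> ('q, 'a, 'x::ab_group_add, 'z) dg_mod_scheme
     \<Rightarrow> nat \<Rightarrow> int \<Rightarrow> (nat \<Rightarrow> 'x \<Rightarrow> 'x) \<Rightarrow> (nat \<Rightarrow> 'x \<Rightarrow> 'x) \<Rightarrow> (nat \<Rightarrow> 'x \<Rightarrow> 'x)
     \<Rightarrow> ((nat \<Rightarrow> nat) \<Rightarrow> 'x \<Rightarrow> 'x) \<Rightarrow> bool"
  where
  "perturbing_system A X n d \<alpha> \<beta> \<gamma> \<tau> \<longleftrightarrow>
     0 < d \<and> odd d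
   \<and> (\<forall>i<n. central_map A X (- d - 1) (\<gamma> i))
   \<and> strong_homotopies A X n d \<alpha> \<beta> \<tau>
   \<and> weighted_sum n \<gamma> \<alpha> \<in> Hom_cycles A X (-1)
   \<and> weighted_sum n \<gamma> \<beta> \<in> Hom_cycles A X (-1)
   \<and> weighted_sum n \<gamma> \<alpha> \<circ> weighted_sum n \<gamma> \<alpha> = (\<lambda>_. 0)
   \<and> weighted_sum n \<gamma> \<beta> \<circ> weighted_sum n \<gamma> \<beta> = (\<lambda>_. 0)
   \<and> (\<forall>x. \<exists>N. \<forall>H \<in> mindex n. msize n H \<ge> N \<longrightarrow> mpow n \<gamma> H x = 0)"

text \<open>For each argument the sum runs over the multi-indices that contribute a nonzero term.\<close>

definition gamma_tau ::
  "nat \<Rightarrow> (nat \<Rightarrow> 'x \<Rightarrow> 'x) \<Rightarrow> ((nat \<Rightarrow> nat) \<Rightarrow> 'x \<Rightarrow> 'x) \<Rightarrow> 'x \<Rightarrow> 'x::ab_group_add" where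
  "gamma_tau n \<gamma> \<tau> x =
     (\<Sum>H | H \<in> mindex n \<and> mpow n \<gamma> H (\<tau> H x) \<noteq> 0. mpow n \<gamma> H (\<tau> H x))"


text \<open>
  \<^term>\<open>gr_morphism X Y f\<close> concerns only the underlying graded modules over the underlying
  graded algebra.
\<close>

definition gr_morphism ::
  "('q::comm_ring_1, 'a::ring_1, 'x::ab_group_add, 'y) dg_mod_scheme
     \<Rightarrow> ('q, 'a, 'w::ab_group_add, 'z) dg_mod_scheme \<Rightarrow> ('x \<Rightarrow> 'w) \<Rightarrow> bool" where
  "gr_morphism X Y f \<longleftrightarrow> module_hom (scale X) (scale Y) f
     \<and> (\<forall>i. \<forall>x \<in> hgrade X i. f x \<in> hgrade Y i)
     \<and> (\<forall>a x. f (act X a x) = act Y a (f x))"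

definition gr_isomorphism ::
  "('q::comm_ring_1, 'a::ring_1, 'x::ab_group_add, 'y) dg_mod_scheme
     \<Rightarrow> ('q, 'a, 'w::ab_group_add, 'z) dg_mod_scheme \<Rightarrow> ('x \<Rightarrow> 'w) \<Rightarrow> bool" where
  "gr_isomorphism X Y f \<longleftrightarrow> gr_morphism X Y f
     \<and> (\<exists>g. gr_morphism Y X g \<and> g \<circ> f = id \<and> f \<circ> g = id)"

definition dg_morphism ::
  "('q::comm_ring_1, 'a::ring_1, 'v) cplx_scheme
     \<Rightarrow> ('q, 'a, 'x::ab_group_add, 'y) dg_mod_scheme
     \<Rightarrow> ('q, 'a, 'w::ab_group_add, 'z) dg_mod_scheme \<Rightarrow> ('x \<Rightarrow> 'w) \<Rightarrow> bool" where
  "dg_morphism A X Y f \<longleftrightarrow> dg_module A X \<and> dg_module A Y \<and> gr_morphism X Y f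
     \<and> (\<forall>x. f (diff X x) = diff Y (f x))"

definition dg_isomorphism ::
  "('q::comm_ring_1, 'a::ring_1, 'v) cplx_scheme
     \<Rightarrow> ('q, 'a, 'x::ab_group_add, 'y) dg_mod_scheme
     \<Rightarrow> ('q, 'a, 'w::ab_group_add, 'z) dg_mod_scheme \<Rightarrow> ('x \<Rightarrow> 'w) \<Rightarrow> bool" where
  "dg_isomorphism A X Y f \<longleftrightarrow> dg_morphism A X Y f
     \<and> (\<exists>g. dg_morphism A Y X g \<and> g \<circ> f = id \<and> f \<circ> g = id)"

end

theory Submission
  imports Defs
begin

text \<open>
  The elements killed by all \<open>\<gamma>^H\<close> with \<open>|H| \<ge> k\<close> form an exhaustive increasing filtration
  starting at 0, preserved by every map that commutes with the \<open>\<gamma>\<^sub>i\<close>.  As \<open>\<tau>\<close> is the identity at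
  the zero multi-index, \<open>\<gamma>\<tau>\<close> differs from the identity by a map that lowers the filtration by one,
  and is therefore bijective on every subgroup that it preserves; applied to the homogeneous
  components this gives an isomorphism of graded modules.  If the \<open>\<gamma>\<^sub>i\<close> are cycles, then
  \<open>[\<partial>, \<gamma>\<tau>] = \<Sum>\<^sub>H \<gamma>^H [\<partial>, \<tau>^(H)]\<close>; shifting the summation index by the \<open>i\<close>-th unit vector in
  the \<open>i\<close>-th summand of the homotopy formula turns this into \<open>\<gamma>\<tau> \<delta> - \<epsilon> \<gamma>\<tau>\<close>.
\<close>

section \<open>Multi-indices of bounded size and the shift by a unit vector\<close>

lemma finite_mindex_msize_less: "finite {H \<in> mindex n. msize n H < N}"
proof (rule finite_subset)
  show "{H \<in> mindex n. msize n H < N}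
      \<subseteq> {H. \<forall>i. (i \<in> {..<n} \<longrightarrow> H i \<in> {..<N}) \<and> (i \<notin> {..<n} \<longrightarrow> H i = 0)}"
  proof clarify
    fix H i
    assume H: "H \<in> mindex n" "msize n H < N"
    have "H i < N" if "i < n"
      using member_le_sum[of i "{..<n}" H] that H(2) unfolding msize_def by simp
    then show "(i \<in> {..<n} \<longrightarrow> H i \<in> {..<N}) \<and> (i \<notin> {..<n} \<longrightarrow> H i = 0)"
      using H(1) by (simp add: mindex_def)
  qed
qed (rule finite_set_of_finite_funs; simp)

lemma msize_add: "msize n (\<lambda>i. H i + K i) = msize n H + msize n K"
  by (simp add: msize_def sum.distrib)

lemma mindex_add: "H \<in> mindex n \<Longrightarrow> K \<in> mindex n \<Longrightarrow> (\<lambda>i. H i + K i) \<in> mindex n"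
  by (simp add: mindex_def)

lemma zero_in_mindex [simp]: "(\<lambda>_. 0) \<in> mindex n"
  by (simp add: mindex_def)

lemma msize_zero [simp]: "msize n (\<lambda>_. 0) = 0"
  by (simp add: msize_def)

lemma msize_eq_0_iff: "H \<in> mindex n \<Longrightarrow> msize n H = 0 \<longleftrightarrow> H = (\<lambda>_. 0)"
  by (auto simp: msize_def mindex_def fun_eq_iff) (metis lessThan_iff not_less)

lemma mindex_inc: "H \<in> mindex n \<Longrightarrow> i < n \<Longrightarrow> H(i := Suc (H i)) \<in> mindex n"
  by (simp add: mindex_def)

lemma msize_inc: "i < n \<Longrightarrow> msize n (H(i := Suc (H i))) = Suc (msize n H)"
  by (simp add: msize_def sum.remove[of "{..<n}" i])

text \<open>Terms with \<open>H i = 0\<close> vanish; on the remaining indices, decrementing the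
  \<open>i\<close>-th entry is a bijection that lowers \<open>msize\<close> by one, hence the bound
  drops from \<open>Suc N\<close> to \<open>N\<close>.\<close>

lemma sum_mindex_shift:
  fixes g :: "(nat \<Rightarrow> nat) \<Rightarrow> 'b::comm_monoid_add"
  assumes "i < n" and "\<And>H. H \<in> mindex n \<Longrightarrow> H i = 0 \<Longrightarrow> g H = 0"
  shows "(\<Sum>H | H \<in> mindex n \<and> msize n H < Suc N. g H)
       = (\<Sum>H | H \<in> mindex n \<and> msize n H < N. g (H(i := Suc (H i))))"
proof -
  have "(\<Sum>H | H \<in> mindex n \<and> msize n H < Suc N. g H)
      = (\<Sum>H | H \<in> mindex n \<and> msize n H < Suc N \<and> H i \<noteq> 0. g H)"
    using assms by (intro sum.mono_neutral_right[OF finite_mindex_msize_less]) auto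
  also have "\<dots> = (\<Sum>H | H \<in> mindex n \<and> msize n H < N. g (H(i := Suc (H i))))"
  proof (rule sum.reindex_bij_witness[where i = "\<lambda>H. H(i := Suc (H i))"
        and j = "\<lambda>H. H(i := H i - 1)"])
    fix H assume H: "H \<in> {H. H \<in> mindex n \<and> msize n H < Suc N \<and> H i \<noteq> 0}"
    then show eq: "(H(i := H i - 1))(i := Suc ((H(i := H i - 1)) i)) = H" by auto
    show "H(i := H i - 1) \<in> {H. H \<in> mindex n \<and> msize n H < N}"
      using H msize_inc[OF assms(1), of "H(i := H i - 1)"] eq by (auto simp: mindex_def)
    show "g ((H(i := H i - 1))(i := Suc ((H(i := H i - 1)) i))) = g H"
      by (simp only: eq)
  qed (auto simp: assms(1) mindex_inc msize_inc)
  finally show ?thesis .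
qed

section \<open>Powers of commuting maps\<close>

lemma mpow_zero [simp]: "mpow n \<gamma> (\<lambda>_. 0) = id"
  by (induction n) auto

lemma mpow_commute:
  assumes "\<And>i x. i < n \<Longrightarrow> \<gamma> i (g x) = g (\<gamma> i x)"
  shows "mpow n \<gamma> H (g x) = g (mpow n \<gamma> H x)"
  using assms
proof (induction n arbitrary: x)
  case (Suc n)
  have "(\<gamma> n ^^ k) (g x) = g ((\<gamma> n ^^ k) x)" for k x
    by (induction k) (auto simp: Suc.prems)
  then show ?case using Suc by simp
qed simp

lemma mpow_cong:
  "(\<And>i. i < n \<Longrightarrow> H i = K i) \<Longrightarrow> mpow n \<gamma> H = mpow n \<gamma> K"
  by (induction n) auto

text \<open>\<open>mpow\<close> applies the factor of largest index first, so the additional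
  \<open>\<gamma> i\<close> reaches the innermost place only by commuting past the factors of larger
  index.\<close>

lemma mpow_inc:
  assumes "\<And>i j x. i < n \<Longrightarrow> j < n \<Longrightarrow> \<gamma> i (\<gamma> j x) = \<gamma> j (\<gamma> i x)" and "i < n"
  shows "mpow n \<gamma> (H(i := Suc (H i))) x = mpow n \<gamma> H (\<gamma> i x)"
  using assms
proof (induction n arbitrary: x)
  case (Suc n)
  show ?case
  proof (cases "i = n")
    case True
    then have "mpow n \<gamma> (H(i := Suc (H i))) = mpow n \<gamma> H"
      by (intro mpow_cong) auto
    then show ?thesis
      using True by (simp add: funpow_swap1 del: fun_upd_apply) (simp add: funpow_swap1)
  next
    case False
    have "(\<gamma> n ^^ k) (\<gamma> i y) = \<gamma> i ((\<gamma> n ^^ k) y)" for k y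
      using Suc.prems by (induction k) auto
    then show ?thesis using False Suc by simp
  qed
qed simp

lemma mpow_add:
  assumes "\<And>i j x. i < n \<Longrightarrow> j < n \<Longrightarrow> \<gamma> i (\<gamma> j x) = \<gamma> j (\<gamma> i x)"
  shows "mpow n \<gamma> (\<lambda>i. H i + K i) x = mpow n \<gamma> H (mpow n \<gamma> K x)"
  using assms
proof (induction n arbitrary: x)
  case (Suc n)
  have "(\<gamma> n ^^ k) (\<gamma> i y) = \<gamma> i ((\<gamma> n ^^ k) y)" if "i < n" for k i y
    using Suc.prems that by (induction k) auto
  then have "mpow n \<gamma> K ((\<gamma> n ^^ k) y) = (\<gamma> n ^^ k) (mpow n \<gamma> K y)" for k y
    by (intro mpow_commute) simp
  then show ?case using Suc by (simp add: funpow_add)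
qed simp

lemma additive_mpow:
  assumes "\<And>i. i < n \<Longrightarrow> additive (\<gamma> i)"
  shows "additive (mpow n \<gamma> H)"
  using assms
proof (induction n)
  case (Suc n)
  have "(\<gamma> n ^^ k) (x + y) = (\<gamma> n ^^ k) x + (\<gamma> n ^^ k) y" for k x y
    using additive.add[OF Suc.prems[of n]] by (induction k) auto
  then show ?case using Suc by (simp add: additive_def)
qed (simp add: additive_def)

section \<open>The filtration and the series on a bare abelian group\<close>

text \<open>Degrees and scalars are left out: for odd \<open>d\<close> the maps
  \<open>\<gamma> i\<close> and \<open>\<tau> H\<close> of a perturbing system have even degree, so
  Koszul signs disappear and centrality becomes plain commutation.\<close>

locale commuting_series =
  fixes n :: nat and \<gamma> :: "nat \<Rightarrow> 'x \<Rightarrow> 'x::ab_group_add" and \<tau> :: "(nat \<Rightarrow> nat) \<Rightarrow> 'x \<Rightarrow> 'x"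
  assumes gamma_additive: "i < n \<Longrightarrow> additive (\<gamma> i)"
    and gamma_commute: "i < n \<Longrightarrow> j < n \<Longrightarrow> \<gamma> i (\<gamma> j x) = \<gamma> j (\<gamma> i x)"
    and tau_additive: "H \<in> mindex n \<Longrightarrow> additive (\<tau> H)"
    and gamma_commute_tau: "H \<in> mindex n \<Longrightarrow> i < n \<Longrightarrow> \<gamma> i (\<tau> H x) = \<tau> H (\<gamma> i x)"
    and tau_zero: "\<tau> (\<lambda>_. 0) = id"
    and locally_nilpotent: "\<exists>N. \<forall>H \<in> mindex n. msize n H \<ge> N \<longrightarrow> mpow n \<gamma> H x = 0"
begin

abbreviation "f \<equiv> gamma_tau n \<gamma> \<tau>"

definition filt :: "nat \<Rightarrow> 'x set" where
  "filt k = {x. \<forall>H \<in> mindex n. k \<le> msize n H \<longrightarrow> mpow n \<gamma> H x = 0}"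

lemmas mpow_additive = additive_mpow[of n \<gamma>, OF gamma_additive]

lemma ex_filt: "\<exists>k. x \<in> filt k"
  using locally_nilpotent[of x] by (simp add: filt_def)

lemma filt_mono: "j \<le> k \<Longrightarrow> filt j \<subseteq> filt k"
  by (auto simp: filt_def)

lemma filt_0: "filt 0 = {0}"
proof -
  have "x = 0" if "x \<in> filt 0" for x
    using that zero_in_mindex[of n] unfolding filt_def
    by (metis (mono_tags, lifting) le0 mem_Collect_eq mpow_zero id_apply)
  moreover have "0 \<in> filt 0"
    by (simp add: filt_def additive.zero[OF mpow_additive])
  ultimately show ?thesis by blast
qed

lemma filt_commute:
  assumes "\<And>i x. i < n \<Longrightarrow> \<gamma> i (g x) = g (\<gamma> i x)" and "g 0 = 0" and "x \<in> filt k"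
  shows "g x \<in> filt k"
  using assms by (auto simp: filt_def mpow_commute[of n \<gamma> g])

lemma filt_minus: "x \<in> filt k \<Longrightarrow> - x \<in> filt k"
  by (simp add: filt_def additive.minus[OF mpow_additive])

lemma filt_sum: "(\<And>i. i \<in> I \<Longrightarrow> g i \<in> filt k) \<Longrightarrow> sum g I \<in> filt k"
  by (simp add: filt_def additive.sum[OF mpow_additive])

lemma tau_filt: "H \<in> mindex n \<Longrightarrow> x \<in> filt k \<Longrightarrow> \<tau> H x \<in> filt k"
  by (rule filt_commute) (auto simp: gamma_commute_tau additive.zero[OF tau_additive])

text \<open>Composing with a further power at \<open>L\<close> gives the power at
  \<open>L + K\<close>, which kills \<open>x\<close> once its size reaches \<open>k\<close>.
  Truncated subtraction is harmless: for \<open>k \<le> msize n K\<close> already the power at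
  \<open>K\<close> kills \<open>x\<close>.\<close>

lemma mpow_filt: "K \<in> mindex n \<Longrightarrow> x \<in> filt k \<Longrightarrow> mpow n \<gamma> K x \<in> filt (k - msize n K)"
  by (auto simp: filt_def mindex_add msize_add simp flip: mpow_add[of n \<gamma>, OF gamma_commute])

lemma term_eq_0:
  "H \<in> mindex n \<Longrightarrow> x \<in> filt N \<Longrightarrow> N \<le> msize n H \<Longrightarrow> mpow n \<gamma> H (\<tau> H x) = 0"
  using tau_filt[of H x N] by (simp add: filt_def)

text \<open>The support in \<open>gamma_tau_def\<close> varies with the point; a finite index set
  depending only on the filtration level lets values at different points be compared
  termwise.\<close>

lemma gamma_tau_eq:
  assumes "x \<in> filt N"
  shows "f x = (\<Sum>H | H \<in> mindex n \<and> msize n H < N. mpow n \<gamma> H (\<tau> H x))"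
  unfolding gamma_tau_def
proof (rule sum.mono_neutral_left[OF finite_mindex_msize_less])
  show "{H \<in> mindex n. mpow n \<gamma> H (\<tau> H x) \<noteq> 0} \<subseteq> {H \<in> mindex n. msize n H < N}"
    using term_eq_0[OF _ assms] by (auto simp: not_le[symmetric])
qed auto

lemma gamma_tau_additive: "additive f"
proof
  fix x y
  obtain j k where "x \<in> filt j" "y \<in> filt k" using ex_filt by meson
  \<comment> \<open>A common level makes all three sums range over the same indices.\<close>
  then have x: "x \<in> filt (max j k)" and y: "y \<in> filt (max j k)"
    using filt_mono[of j "max j k"] filt_mono[of k "max j k"] by auto
  then have "x + y \<in> filt (max j k)"
    by (simp add: filt_def additive.add[OF mpow_additive])
  with x y show "f (x + y) = f x + f y"
    by (simp add: gamma_tau_eq additive.add[OF mpow_additive] additive.add[OF tau_additive] sum.distrib)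
qed

text \<open>Serves both the scalar multiplications and the action of \<open>A\<close>.\<close>

lemma gamma_tau_commute_map:
  assumes "additive g" and g: "\<And>i x. i < n \<Longrightarrow> \<gamma> i (g x) = g (\<gamma> i x)"
    and "\<And>H x. H \<in> mindex n \<Longrightarrow> \<tau> H (g x) = g (\<tau> H x)"
  shows "f (g x) = g (f x)"
proof -
  obtain k where x: "x \<in> filt k" using ex_filt by blast
  then have "g x \<in> filt k" using filt_commute[of g, OF g] additive.zero[OF assms(1)] by blast
  with x show ?thesis
    by (simp add: gamma_tau_eq additive.sum[OF assms(1)] assms(3) mpow_commute[of n \<gamma> g, OF g])
qed

text \<open>The term at the zero multi-index is \<open>x\<close>; every other term contains at least
  one factor \<open>\<gamma> i\<close> and so drops a level.\<close>

lemma gamma_tau_diff_id_filt: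
  assumes x: "x \<in> filt (Suc k)"
  shows "f x - x \<in> filt k"
proof -
  let ?T = "{H \<in> mindex n. msize n H < Suc k}"
  have "f x = mpow n \<gamma> (\<lambda>_. 0) (\<tau> (\<lambda>_. 0) x) + (\<Sum>H\<in>?T - {\<lambda>_. 0}. mpow n \<gamma> H (\<tau> H x))"
    unfolding gamma_tau_eq[OF x] by (rule sum.remove[OF finite_mindex_msize_less]) simp
  then have "f x - x = (\<Sum>H\<in>?T - {\<lambda>_. 0}. mpow n \<gamma> H (\<tau> H x))"
    by (simp add: tau_zero)
  moreover have "mpow n \<gamma> H (\<tau> H x) \<in> filt k" if "H \<in> ?T - {\<lambda>_. 0}" for H
  proof -
    have "Suc k - msize n H \<le> k" using that msize_eq_0_iff[of H n] by auto
    then show ?thesis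
      using filt_mono mpow_filt[of H "\<tau> H x"] tau_filt[of H x] that x by blast
  qed
  ultimately show ?thesis using filt_sum[of "?T - {\<lambda>_. 0}"] by presburger
qed

text \<open>If \<open>f x = 0\<close>, then \<open>f x - x = - x\<close> lies one level lower than
  \<open>x\<close>; descending to \<open>filt 0\<close> gives \<open>x = 0\<close>.\<close>

lemma gamma_tau_inj: "inj f"
proof -
  have "x = 0" if "x \<in> filt k" "f x = 0" for k x
    using that
  proof (induction k)
    case (Suc k)
    then show ?case using gamma_tau_diff_id_filt[of x k] filt_minus[of "-x" k] by simp
  qed (simp add: filt_0)
  then have *: "x = 0" if "f x = 0" for x using ex_filt that by blast
  show ?thesis
  proof (rule injI)
    fix x y assume "f x = f y"
    then have "f (x - y) = 0" by (simp add: additive.diff[OF gamma_tau_additive])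
    then show "x = y" using * by fastforce
  qed
qed

text \<open>\<open>S\<close> is an arbitrary subgroup so that one induction yields surjectivity,
  with \<open>S = UNIV\<close>, and bijectivity on each homogeneous component.\<close>

lemma gamma_tau_image:
  assumes S: "0 \<in> S" "\<And>x y. x \<in> S \<Longrightarrow> y \<in> S \<Longrightarrow> x - y \<in> S"
    and f: "\<And>x. x \<in> S \<Longrightarrow> f x \<in> S"
  shows "f ` S = S"
proof -
  have "y \<in> f ` S" if "y \<in> filt k" "y \<in> S" for k y
    using that
  proof (induction k arbitrary: y)
    case 0
    then show ?case using S(1) additive.zero[OF gamma_tau_additive] by (force simp: filt_0)
  next
    case (Suc k)
    \<comment> \<open>The error \<open>f y - y\<close> stays in \<open>S\<close> and lies one level
      lower, so the induction hypothesis gives it a preimage \<open>z\<close>; then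
      \<open>y - z\<close> is a preimage of \<open>y\<close>.\<close>
    then obtain z where z: "z \<in> S" "f y - y = f z"
      using gamma_tau_diff_id_filt S(2) f by blast
    then have "f (y - z) = y" by (simp add: additive.diff[OF gamma_tau_additive] flip: z(2))
    then show ?case using S(2) Suc.prems(2) z(1) by (metis image_eqI)
  qed
  then show ?thesis using ex_filt f by blast
qed

lemma perturbed_diff_gamma_tau:
  assumes D: "additive D" "\<And>i x. i < n \<Longrightarrow> \<gamma> i (D x) = D (\<gamma> i x)"
    and \<alpha>: "\<And>i. i < n \<Longrightarrow> additive (\<alpha> i)" "\<And>i j x. i < n \<Longrightarrow> j < n \<Longrightarrow> \<gamma> j (\<alpha> i x) = \<alpha> i (\<gamma> j x)"
    and \<beta>: "\<And>i. i < n \<Longrightarrow> additive (\<beta> i)" "\<And>i j x. i < n \<Longrightarrow> j < n \<Longrightarrow> \<gamma> j (\<beta> i x) = \<beta> i (\<gamma> j x)"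
    and homotopy: "\<And>H x. H \<in> mindex n \<Longrightarrow> 0 < msize n H \<Longrightarrow> D (\<tau> H x) - \<tau> H (D x)
                 = (\<Sum>i<n. at_dec \<tau> H i (\<alpha> i x) - \<beta> i (at_dec \<tau> H i x))"
  shows "f (D x + weighted_sum n \<gamma> \<alpha> x) = D (f x) + weighted_sum n \<gamma> \<beta> (f x)"
proof -
  obtain N where x: "x \<in> filt N" using ex_filt by blast
  define \<delta> where "\<delta> = weighted_sum n \<gamma> \<alpha>"
  define \<epsilon> where "\<epsilon> = weighted_sum n \<gamma> \<beta>"
  let ?T = "\<lambda>N. {H \<in> mindex n. msize n H < N}"
  have Dx: "D x \<in> filt N" by (rule filt_commute[OF D(2) additive.zero[OF D(1)] x])
  have \<delta>_comm: "\<gamma> i (\<delta> y) = \<delta> (\<gamma> i y)" if "i < n" for i y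
    using that by (simp add: \<delta>_def weighted_sum_def additive.sum[OF gamma_additive] gamma_commute \<alpha>(2))
  have \<epsilon>_comm: "\<gamma> i (\<epsilon> y) = \<epsilon> (\<gamma> i y)" if "i < n" for i y
    using that by (simp add: \<epsilon>_def weighted_sum_def additive.sum[OF gamma_additive] gamma_commute \<beta>(2))
  have \<delta>0: "\<delta> 0 = 0"
    by (simp add: \<delta>_def weighted_sum_def additive.zero[OF gamma_additive] additive.zero[OF \<alpha>(1)])
  have \<epsilon>_add: "additive \<epsilon>"
    by (simp add: additive_def \<epsilon>_def weighted_sum_def additive.add[OF gamma_additive]
        additive.add[OF \<beta>(1)] sum.distrib)
  have \<delta>x: "\<delta> x \<in> filt N" by (rule filt_commute[OF \<delta>_comm \<delta>0 x])
  \<comment> \<open>The level is raised to \<open>Suc N\<close> because the index shift lowers the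
    bound by one, back to the level \<open>N\<close> of \<open>x\<close> and
    \<open>\<delta> x\<close>.\<close>
  have xS: "x \<in> filt (Suc N)" and DxS: "D x \<in> filt (Suc N)"
    using x Dx filt_mono[of N "Suc N"] by auto
  \<comment> \<open>The formula extends to the zero multi-index: \<open>\<tau>\<close> is the
    identity there and every \<open>at_dec\<close> is zero by convention.\<close>
  have comm: "D (\<tau> H x) - \<tau> H (D x) = (\<Sum>i<n. at_dec \<tau> H i (\<alpha> i x) - \<beta> i (at_dec \<tau> H i x))"
    if "H \<in> mindex n" for H
  proof (cases "msize n H = 0")
    case True
    then show ?thesis using msize_eq_0_iff[OF that]
      by (simp add: tau_zero at_dec_def additive.zero[OF \<beta>(1)])
  qed (use that homotopy in auto)
  have shift: "(\<Sum>H\<in>?T (Suc N). mpow n \<gamma> H (at_dec \<tau> H i (\<alpha> i x) - \<beta> i (at_dec \<tau> H i x)))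
      = (\<Sum>H\<in>?T N. mpow n \<gamma> H (\<tau> H (\<gamma> i (\<alpha> i x)) - \<gamma> i (\<beta> i (\<tau> H x))))" if i: "i < n" for i
  proof -
    have "(\<Sum>H\<in>?T (Suc N). mpow n \<gamma> H (at_dec \<tau> H i (\<alpha> i x) - \<beta> i (at_dec \<tau> H i x)))
       = (\<Sum>H\<in>?T N. mpow n \<gamma> (H(i := Suc (H i)))
            (at_dec \<tau> (H(i := Suc (H i))) i (\<alpha> i x) - \<beta> i (at_dec \<tau> (H(i := Suc (H i))) i x)))"
      by (rule sum_mindex_shift[OF i])
        (simp add: at_dec_def i additive.zero[OF \<beta>(1)] additive.zero[OF mpow_additive])
    \<comment> \<open>After the shift \<open>at_dec\<close> returns \<open>\<tau> H\<close>, and the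
      factor \<open>\<gamma> i\<close> split off by \<open>mpow_inc\<close> moves past
      \<open>\<tau> H\<close> to stand before \<open>\<alpha> i\<close>.\<close>
    also have "\<dots> = (\<Sum>H\<in>?T N. mpow n \<gamma> H (\<tau> H (\<gamma> i (\<alpha> i x)) - \<gamma> i (\<beta> i (\<tau> H x))))"
      using i by (intro sum.cong) (auto simp: at_dec_def mpow_inc[of n \<gamma>, OF gamma_commute]
          additive.diff[OF gamma_additive] gamma_commute_tau)
    finally show ?thesis .
  qed
  have "D (f x) - f (D x) = (\<Sum>H\<in>?T (Suc N). mpow n \<gamma> H (D (\<tau> H x) - \<tau> H (D x)))"
    unfolding gamma_tau_eq[OF xS] gamma_tau_eq[OF DxS]
    by (simp add: additive.sum[OF D(1)] additive.diff[OF mpow_additive] sum_subtractf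
        mpow_commute[of n \<gamma> D, OF D(2)])
  also have "\<dots> = (\<Sum>H\<in>?T (Suc N). \<Sum>i<n. mpow n \<gamma> H (at_dec \<tau> H i (\<alpha> i x) - \<beta> i (at_dec \<tau> H i x)))"
    by (intro sum.cong) (auto simp: comm additive.sum[OF mpow_additive])
  \<comment> \<open>The sum over \<open>i\<close> goes outside since the shift depends on
    \<open>i\<close>.\<close>
  also have "\<dots> = (\<Sum>i<n. \<Sum>H\<in>?T (Suc N). mpow n \<gamma> H (at_dec \<tau> H i (\<alpha> i x) - \<beta> i (at_dec \<tau> H i x)))"
    by (rule sum.swap)
  also have "\<dots> = (\<Sum>i<n. \<Sum>H\<in>?T N. mpow n \<gamma> H (\<tau> H (\<gamma> i (\<alpha> i x)) - \<gamma> i (\<beta> i (\<tau> H x))))"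
    by (rule sum.cong[OF refl]) (rule shift, simp)
  also have "\<dots> = (\<Sum>H\<in>?T N. \<Sum>i<n. mpow n \<gamma> H (\<tau> H (\<gamma> i (\<alpha> i x)) - \<gamma> i (\<beta> i (\<tau> H x))))"
    by (rule sum.swap)
  also have "\<dots> = (\<Sum>H\<in>?T N. mpow n \<gamma> H (\<tau> H (\<delta> x)) - mpow n \<gamma> H (\<epsilon> (\<tau> H x)))"
    by (intro sum.cong) (auto simp: \<delta>_def \<epsilon>_def weighted_sum_def additive.sum[OF mpow_additive]
        additive.sum[OF tau_additive] additive.diff[OF mpow_additive] sum_subtractf)
  also have "\<dots> = f (\<delta> x) - \<epsilon> (f x)"
    unfolding gamma_tau_eq[OF x] gamma_tau_eq[OF \<delta>x]
    by (simp add: sum_subtractf additive.sum[OF \<epsilon>_add] mpow_commute[of n \<gamma> \<epsilon>, OF \<epsilon>_comm])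
  finally show ?thesis
    by (simp add: additive.add[OF gamma_tau_additive] \<delta>_def \<epsilon>_def algebra_simps)
qed

end

section \<open>Homogeneous maps and perturbed DG modules\<close>

lemma ksgn_even: "even k \<Longrightarrow> ksgn k x = x"
  by (simp add: ksgn_def)

lemma module_hom_additive: "module_hom s t g \<Longrightarrow> additive g"
  by (simp add: additive_def module_hom_iff)

lemma perturb_simps [simp]:
  "scale (perturb X e) = scale X" "hgrade (perturb X e) = hgrade X" "act (perturb X e) = act X"
  "diff (perturb X e) = (\<lambda>x. diff X x + e x)"
  by (simp_all add: perturb_def)

lemma Hom_deg_additive: "g \<in> Hom_deg A X k \<Longrightarrow> additive g"
  by (auto simp: Hom_deg_def intro: module_hom_additive)

lemma Hom_deg_scale: "g \<in> Hom_deg A X k \<Longrightarrow> g (scale X q x) = scale X q (g x)"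
  by (auto simp: Hom_deg_def module_hom_iff)

lemma Hom_deg_degree: "g \<in> Hom_deg A X k \<Longrightarrow> x \<in> hgrade X i \<Longrightarrow> g x \<in> hgrade X (i + k)"
  by (auto simp: Hom_deg_def)

lemma central_map_commute:
  "central_map A X k c \<Longrightarrow> even k \<Longrightarrow> s \<in> Hom_deg A X l \<Longrightarrow> c (s x) = s (c x)"
  unfolding central_map_def by (auto simp: ksgn_even fun_eq_iff)

context dg_module
begin

text \<open>\<open>Hom_deg\<close> prescribes the sign rule for homogeneous \<open>a\<close> only;
  in even degree no sign depends on the component, so the rule extends to all \<open>a\<close> by
  summation.\<close>

lemma Hom_deg_even_act:
  assumes g: "g \<in> Hom_deg A X k" and "even k"
  shows "g (act X a x) = act X a (g x)"
proof -
  obtain c where c: "\<And>i. c i \<in> hgrade A i" "a = (\<Sum>i | c i \<noteq> 0. c i)"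
    using A.direct_sum[of a] by blast
  have act: "additive (\<lambda>b. act X b y)" for y
    by (simp add: additive_def act_add_left)
  have hom: "g (act X (c i) x) = act X (c i) (g x)" for i
    using g c(1)[of i] \<open>even k\<close> by (simp add: Hom_deg_def ksgn_even)
  show ?thesis
    unfolding c(2) additive.sum[OF act] additive.sum[OF Hom_deg_additive[OF g]] by (simp add: hom)
qed

text \<open>For \<open>e\<close> of degree -1 the cycle condition is
  \<open>\<partial> e + e \<partial> = 0\<close>, so the square of \<open>\<partial> + e\<close>
  reduces to \<open>e^2 = 0\<close>. The Leibniz rule survives because \<open>e\<close> passes
  \<open>a\<close> with the same sign as \<open>\<partial>\<close> does.\<close>

lemma dg_module_perturb:
  assumes e: "e \<in> Hom_cycles A X (-1)" and ee: "e \<circ> e = (\<lambda>_. 0)"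
  shows "dg_module A (perturb X e)"
proof -
  have e': "e \<in> Hom_deg A X (-1)" and cyc: "diff X (e x) + e (diff X x) = 0" for x
    using e by (auto simp: Hom_cycles_def hom_diff_def gcomm_def ksgn_def fun_eq_iff)
  have ee': "e (e x) = 0" for x using ee by (simp add: fun_eq_iff)
  note add = additive.add[OF Hom_deg_additive[OF e']]
    additive.add[OF module_hom_additive[OF X.diff_linear]]
  have act_e: "e (act X a x) = ksgn i (act X a (e x))" if "a \<in> hgrade A i" for a i x
    using e' that by (simp add: Hom_deg_def ksgn_def)
  have graded: "graded_module (perturb X e)"
    using X.graded_module_axioms by (simp add: graded_module_def graded_module_axioms_def perturb_def)
  have "dg_complex (perturb X e)"
  proof (intro dg_complex.intro graded dg_complex_axioms.intro)
    show "module_hom (scale (perturb X e)) (scale (perturb X e)) (diff (perturb X e))"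
      using X.diff_linear e' by (auto simp: Hom_deg_def module_hom_iff X.scale_right_distrib)
    show "diff (perturb X e) x \<in> hgrade (perturb X e) (i - 1)"
      if "x \<in> hgrade (perturb X e) i" for x i
      using that X.diff_degree[of x i] Hom_deg_degree[OF e', of x i] X.subspace_add[OF X.hgrade_subspace]
      by simp
    show "diff (perturb X e) (diff (perturb X e) x) = 0" for x
      using cyc[of x] by (simp add: add ee' X.diff_diff algebra_simps)
  qed
  moreover have "dg_module_axioms A (perturb X e)"
    using act_add_left act_mult act_one act_scale_left act_scale_right act_degree
    by unfold_locales
      (auto simp: act_add_right act_Leibniz act_e ksgn_def)
  ultimately show ?thesis
    by (intro dg_module.intro A.dg_algebra_axioms)
qed

end

section \<open>The map of a perturbing system\<close>

locale perturbed_dg_module = dg_module A X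
  for A :: "('q::comm_ring_1, 'a::ring_1) cplx"
    and X :: "('q, 'a, 'x::ab_group_add) dg_mod" +
  fixes n :: nat and d :: int
    and \<alpha> \<beta> \<gamma> :: "nat \<Rightarrow> 'x \<Rightarrow> 'x"
    and \<tau> :: "(nat \<Rightarrow> nat) \<Rightarrow> 'x \<Rightarrow> 'x"
  assumes perturbing: "perturbing_system A X n d \<alpha> \<beta> \<gamma> \<tau>"
begin

abbreviation "\<delta> \<equiv> weighted_sum n \<gamma> \<alpha>"
abbreviation "\<epsilon> \<equiv> weighted_sum n \<gamma> \<beta>"

lemma odd_d: "odd d"
  and central: "i < n \<Longrightarrow> central_map A X (- d - 1) (\<gamma> i)"
  and alpha: "i < n \<Longrightarrow> \<alpha> i \<in> Hom_deg A X d"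
  and beta: "i < n \<Longrightarrow> \<beta> i \<in> Hom_deg A X d"
  and tau: "H \<in> mindex n \<Longrightarrow> \<tau> H \<in> Hom_deg A X (int (msize n H) * (d + 1))"
  using perturbing by (auto simp: perturbing_system_def strong_homotopies_def)

lemma gamma: "i < n \<Longrightarrow> \<gamma> i \<in> Hom_deg A X (- d - 1)"
  using central by (auto simp: central_map_def)

lemma gamma_central: "i < n \<Longrightarrow> s \<in> Hom_deg A X k \<Longrightarrow> \<gamma> i (s x) = s (\<gamma> i x)"
  using central_map_commute[OF central] odd_d by simp

sublocale commuting_series n \<gamma> \<tau>
proof
  show "\<tau> (\<lambda>_. 0) = id" "\<exists>N. \<forall>H\<in>mindex n. N \<le> msize n H \<longrightarrow> mpow n \<gamma> H x = 0" for x
    using perturbing by (auto simp: perturbing_system_def strong_homotopies_def)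
qed (simp_all add: gamma_central[OF _ gamma] gamma_central[OF _ tau]
    additive.add[OF Hom_deg_additive[OF gamma]] additive.add[OF Hom_deg_additive[OF tau]])

text \<open>The shift is the negative of the degree of \<open>\<tau> H\<close>, so every term of the
  series has degree 0.\<close>

lemma mpow_degree:
  assumes x: "x \<in> hgrade X j"
  shows "mpow n \<gamma> H x \<in> hgrade X (j - int (msize n H) * (d + 1))"
proof -
  \<comment> \<open>The induction runs over partial products, whose size is a partial sum, and over
    all degrees \<open>l\<close>, since the factor applied first changes the degree.\<close>
  have "mpow m \<gamma> H y \<in> hgrade X (l - int (\<Sum>i<m. H i) * (d + 1))"
    if "m \<le> n" "y \<in> hgrade X l" for m y l
    using that
  proof (induction m arbitrary: y l)
    case (Suc m)
    have "(\<gamma> m ^^ k) y \<in> hgrade X (l - int k * (d + 1))" for k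
    proof (induction k)
      case (Suc k)
      have "l - int k * (d + 1) + (- d - 1) = l - int (Suc k) * (d + 1)"
        by (simp add: algebra_simps)
      moreover have "\<gamma> m ((\<gamma> m ^^ k) y) \<in> hgrade X (l - int k * (d + 1) + (- d - 1))"
        using Hom_deg_degree[OF gamma Suc, of m] \<open>Suc m \<le> n\<close> by simp
      ultimately show ?case
        by (simp only: funpow.simps comp_apply)
    qed (simp add: Suc.prems)
    then have "mpow m \<gamma> H ((\<gamma> m ^^ H m) y)
        \<in> hgrade X (l - int (H m) * (d + 1) - int (\<Sum>i<m. H i) * (d + 1))"
      using Suc.prems(1) by (intro Suc.IH) auto
    then show ?case by (simp add: algebra_simps)
  qed simp
  with x show ?thesis by (simp add: msize_def)
qed

lemma gamma_tau_degree:
  assumes "x \<in> hgrade X i"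
  shows "f x \<in> hgrade X i"
  unfolding gamma_tau_def
proof (rule X.subspace_sum[OF X.hgrade_subspace])
  fix H assume H: "H \<in> {H \<in> mindex n. mpow n \<gamma> H (\<tau> H x) \<noteq> 0}"
  then show "mpow n \<gamma> H (\<tau> H x) \<in> hgrade X i"
    using mpow_degree[OF Hom_deg_degree[OF tau assms], of H H] by simp
qed

lemma gamma_tau_scale: "f (scale X q x) = scale X q (f x)"
  by (rule gamma_tau_commute_map)
    (auto simp: additive_def X.scale_right_distrib Hom_deg_scale[OF gamma] Hom_deg_scale[OF tau])

lemma gamma_tau_act: "f (act X a x) = act X a (f x)"
proof (rule gamma_tau_commute_map)
  show "\<gamma> i (act X a x) = act X a (\<gamma> i x)" if "i < n" for i x
    using Hom_deg_even_act[OF gamma[OF that]] odd_d by simp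
  show "\<tau> H (act X a x) = act X a (\<tau> H x)" if "H \<in> mindex n" for H x
    using Hom_deg_even_act[OF tau[OF that]] odd_d by simp
qed (simp add: additive_def act_add_right)

lemma gamma_tau_hgrade_image: "f ` hgrade X i = hgrade X i"
  by (rule gamma_tau_image)
    (auto intro: gamma_tau_degree X.subspace_0 X.subspace_diff X.hgrade_subspace)

lemma gamma_tau_surj: "surj f"
  using gamma_tau_image[of UNIV] by simp

text \<open>Uniqueness of preimages makes the inverse linear over \<open>Q\<close> and
  \<open>A\<close>; it preserves degrees because \<open>f\<close> maps each homogeneous component
  onto itself.\<close>

lemma gr_isomorphism_gamma_tau: "gr_isomorphism (perturb X \<delta>) (perturb X \<epsilon>) f"
proof -
  let ?g = "inv f"
  have fg: "f (?g y) = y" for y by (rule surj_f_inv_f[OF gamma_tau_surj])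
  have gI: "?g y = x" if "f x = y" for x y
    using that gamma_tau_inj by auto
  have hom: "module_hom (scale X) (scale X) f"
    using X.module_axioms
    by (simp add: module_hom_iff additive.add[OF gamma_tau_additive] gamma_tau_scale)
  have "module_hom (scale X) (scale X) ?g"
    using X.module_axioms
    by (auto simp: module_hom_iff additive.add[OF gamma_tau_additive] gamma_tau_scale fg intro!: gI)
  moreover have "?g y \<in> hgrade X i" if "y \<in> hgrade X i" for y i
  proof -
    have "y \<in> f ` hgrade X i" using \<open>y \<in> hgrade X i\<close> by (simp only: gamma_tau_hgrade_image)
    then obtain x where "x \<in> hgrade X i" "f x = y" by blast
    then show ?thesis using gI[of x y] by simp
  qed
  moreover have "?g (act X a y) = act X a (?g y)" for a y
    by (rule gI) (simp add: gamma_tau_act fg)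
  ultimately have "gr_morphism (perturb X \<epsilon>) (perturb X \<delta>) ?g"
    by (simp add: gr_morphism_def)
  moreover have "gr_morphism (perturb X \<delta>) (perturb X \<epsilon>) f"
    using hom gamma_tau_degree gamma_tau_act by (simp add: gr_morphism_def)
  moreover have "?g \<circ> f = id" "f \<circ> ?g = id"
    using fg gI by (auto simp: fun_eq_iff)
  ultimately show ?thesis
    unfolding gr_isomorphism_def by blast
qed

text \<open>In the even degree \<open>- d - 1\<close> a cycle is a map commuting with
  \<open>diff X\<close>; this is what allows the differential to pass through the powers of the
  \<open>\<gamma> i\<close>.\<close>

lemma dg_morphism_gamma_tau:
  assumes "\<forall>i<n. \<gamma> i \<in> Hom_cycles A X (- d - 1)"
  shows "dg_morphism A (perturb X \<delta>) (perturb X \<epsilon>) f"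
proof -
  have homotopy: "diff X (\<tau> H x) - \<tau> H (diff X x)
      = (\<Sum>i<n. at_dec \<tau> H i (\<alpha> i x) - \<beta> i (at_dec \<tau> H i x))"
    if "H \<in> mindex n" "0 < msize n H" for H x
  proof -
    have "hom_diff X (int (msize n H) * (d + 1)) (\<tau> H) x
        = (\<Sum>i<n. at_dec \<tau> H i (\<alpha> i x) - \<beta> i (at_dec \<tau> H i x))"
      using perturbing that by (simp add: perturbing_system_def strong_homotopies_def)
    \<comment> \<open>\<open>\<tau> H\<close> has even degree, so its bracket with the differential
      is a plain commutator.\<close>
    then show ?thesis using odd_d by (simp add: hom_diff_def gcomm_def ksgn_even)
  qed
  have "\<gamma> i (diff X x) = diff X (\<gamma> i x)" if "i < n" for i x
    using assms that odd_d
    by (auto simp: Hom_cycles_def hom_diff_def gcomm_def ksgn_even fun_eq_iff)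
  then have "f (diff X x + \<delta> x) = diff X (f x) + \<epsilon> (f x)" for x
    by (intro perturbed_diff_gamma_tau module_hom_additive[OF X.diff_linear] homotopy)
      (auto intro: Hom_deg_additive alpha beta gamma_central)
  moreover have "dg_module A (perturb X \<delta>)" "dg_module A (perturb X \<epsilon>)"
    using perturbing by (auto simp: perturbing_system_def intro: dg_module_perturb)
  ultimately show ?thesis
    using gr_isomorphism_gamma_tau by (simp add: dg_morphism_def gr_isomorphism_def)
qed

end

section \<open>Isomorphisms of DG modules\<close>

text \<open>The inverse of a bijective chain map is a chain map: \<open>f\<close> sends
  \<open>diff X (g y)\<close> to \<open>diff Y y\<close>, and applying \<open>g\<close> gives the
  claim.\<close>

lemma dg_isomorphismI:
  assumes f: "dg_morphism A X Y f" and "gr_isomorphism X Y f"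
  shows "dg_isomorphism A X Y f"
proof -
  obtain g where g: "gr_morphism Y X g" "g \<circ> f = id" "f \<circ> g = id"
    using assms(2) by (auto simp: gr_isomorphism_def)
  have gf: "g (f x) = x" and fg: "f (g y) = y" for x y
    using g(2,3) by (simp_all add: fun_eq_iff)
  have "g (diff Y y) = diff X (g y)" for y
    using f gf[of "diff X (g y)"] fg[of y] by (simp add: dg_morphism_def)
  with f g show ?thesis by (auto simp: dg_isomorphism_def dg_morphism_def)
qed

text \<open>The graded isomorphism holds for every perturbing system. Compatibility with the
  differentials is either presupposed or derived from the \<open>\<gamma> i\<close> being cycles,
  because central maps need not be cycles.\<close>

theorem theorem4p10:
  fixes A :: "('q::comm_ring_1, 'a::ring_1) cplx"
    and X :: "('q, 'a, 'x::ab_group_add) dg_mod"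
    and n :: nat and d :: int
    and \<alpha> \<beta> \<gamma> :: "nat \<Rightarrow> 'x \<Rightarrow> 'x"
    and \<tau> :: "(nat \<Rightarrow> nat) \<Rightarrow> 'x \<Rightarrow> 'x"
    and \<delta> \<epsilon> :: "'x \<Rightarrow> 'x"
  assumes "gc_dg_algebra A"
    and "dg_module A X"
    and "perturbing_system A X n d \<alpha> \<beta> \<gamma> \<tau>"
    and "\<delta> = weighted_sum n \<gamma> \<alpha>"
    and "\<epsilon> = weighted_sum n \<gamma> \<beta>"
  shows "gr_isomorphism (perturb X \<delta>) (perturb X \<epsilon>) (gamma_tau n \<gamma> \<tau>)
    \<and> (dg_morphism A (perturb X \<delta>) (perturb X \<epsilon>) (gamma_tau n \<gamma> \<tau>)
         \<longrightarrow> dg_isomorphism A (perturb X \<delta>) (perturb X \<epsilon>) (gamma_tau n \<gamma> \<tau>))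
    \<and> ((\<forall>i<n. \<gamma> i \<in> Hom_cycles A X (- d - 1))
         \<longrightarrow> dg_isomorphism A (perturb X \<delta>) (perturb X \<epsilon>) (gamma_tau n \<gamma> \<tau>))"
proof -
  interpret dg_module A X by (rule assms(2))
  interpret perturbed_dg_module A X n d \<alpha> \<beta> \<gamma> \<tau>
    by unfold_locales (rule assms(3))
  show ?thesis
    unfolding assms(4,5)
    using gr_isomorphism_gamma_tau dg_morphism_gamma_tau dg_isomorphismI by blast
qed

end
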